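(* The cut polytope $\operatorname{Cut}^{\Box}(K_5)$ of the complete graph on five vertices is not seminormal. In particular, it is not normal.
   Context: For a graph $G=(V,E)$ and $A\subseteq V$ the cut vector $\delta_A\in\mathbb{R}^E$ has $\delta_{A,e}=1$ if $|A\cap e|=1$ and $0$ otherwise; $\operatorname{Cut}^{\Box}(G)=\operatorname{conv}\{\delta_A:A\subseteq V\}$, and $M_G$ is the affine monoid generated by the vectors $(\delta_A,1)\in\mathbb{Z}^{E}\times\mathbb{Z}$. A monoid $M$ with group $\operatorname{gp}(M)$ is seminormal if every $x\in\operatorname{gp}(M)$ with $2x,3x\in M$ satisfies $x\in M$; it is normal if every $x\in\operatorname{gp}(M)$ with $nx\in M$ for some positive integer $n$ lies in $M$. The cut polytope is called (semi)normal if $M_G$ is (equivalently, if the cut algebra $\mathbb{K}[M_G]$ over a field $\mathbb{K}$ is). *)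

theory Defs
  imports
    Complex_Main
    "HOL-Library.Function_Algebras"
    "HOL-Library.Product_Plus"
    "HOL-Computational_Algebra.Group_Closure"
begin

section \<open>Normal and seminormal monoids\<close>

inductive_set monoid_generated :: "'a::comm_monoid_add set \<Rightarrow> 'a set" for S where
  zero: "0 \<in> monoid_generated S"
| step: "s \<in> S \<Longrightarrow> x \<in> monoid_generated S \<Longrightarrow> s + x \<in> monoid_generated S"

text \<open>
  The monoids here are submonoids \<open>M\<close> of an abelian group, so the group \<open>gp(M)\<close> is the
  subgroup \<^term>\<open>group_closure M\<close> generated by \<open>M\<close>, and the multiple \<open>n x\<close> is the \<open>n\<close>-fold sum
  \<open>\<Sum>i<n. x\<close>.
\<close>

definition normal_monoid :: "'a::ab_group_add set \<Rightarrow> bool" where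
  "normal_monoid M \<longleftrightarrow>
     (\<forall>x \<in> group_closure M. (\<exists>n>0. (\<Sum>i<(n::nat). x) \<in> M) \<longrightarrow> x \<in> M)"

definition seminormal_monoid :: "'a::ab_group_add set \<Rightarrow> bool" where
  "seminormal_monoid M \<longleftrightarrow>
     (\<forall>x \<in> group_closure M. x + x \<in> M \<and> x + x + x \<in> M \<longrightarrow> x \<in> M)"

section \<open>Cut monoids of graphs\<close>

text \<open>A graph is a pair of a vertex set and a set of edges, each edge being a two-element set.\<close>

type_synonym 'a graph = "'a set \<times> 'a set set"

definition complete_graph :: "'a set \<Rightarrow> 'a graph" where
  "complete_graph V = (V, {e. e \<subseteq> V \<and> card e = 2})"

text \<open>
  \<open>\<int>\<^sup>E\<close> is realised as the integer functions on all sets of vertices that vanish outside \<open>E\<close>,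
  with pointwise addition.
\<close>

definition cut_vector :: "'a graph \<Rightarrow> 'a set \<Rightarrow> 'a set \<Rightarrow> int" where
  "cut_vector G A = (\<lambda>e. if e \<in> snd G \<and> card (A \<inter> e) = 1 then 1 else 0)"

definition cut_monoid :: "'a graph \<Rightarrow> (('a set \<Rightarrow> int) \<times> int) set" where
  "cut_monoid G = monoid_generated {(cut_vector G A, 1) | A. A \<subseteq> fst G}"

text \<open>
  The cut polytope of \<open>G\<close> is the convex hull of the cut vectors of \<open>G\<close>; by definition it is called
  (semi)normal if the monoid \<^term>\<open>cut_monoid G\<close> is.
\<close>

definition cut_polytope_normal :: "'a graph \<Rightarrow> bool" where
  "cut_polytope_normal G \<longleftrightarrow> normal_monoid (cut_monoid G)"

definition cut_polytope_seminormal :: "'a graph \<Rightarrow> bool" where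
  "cut_polytope_seminormal G \<longleftrightarrow> seminormal_monoid (cut_monoid G)"

end

theory Submission
  imports Defs
begin

text \<open>
  The witness is \<open>x = (2, \<dots>, 2; 4)\<close>. Writing \<open>V = {a, b, c, d, e}\<close>, the element \<open>2x\<close> is the sum of
  the cuts of the sets \<open>{v}\<close> and \<open>{a, v}\<close> for \<open>v \<noteq> a\<close>, and \<open>3x\<close> is the sum of the cuts of all ten
  pairs together with two empty cuts; hence also \<open>x = 3x - 2x\<close> lies in the group. If \<open>x\<close> were in the
  monoid, it would be a sum of four cuts, and their indicator functions would assign to the five
  vertices words in \<open>{0,1}\<^sup>4\<close> at mutual Hamming distance \<open>2\<close>. Such words all have the same parity,
  and the eight words of one parity form four antipodal pairs, so two of the five words are equal
  or antipodal, that is, at distance \<open>0\<close> or \<open>4\<close>.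
\<close>

lemma monoid_generated_iff_sum_list:
  "x \<in> monoid_generated S \<longleftrightarrow> (\<exists>xs. set xs \<subseteq> S \<and> x = sum_list xs)"
proof
  assume "x \<in> monoid_generated S"
  then show "\<exists>xs. set xs \<subseteq> S \<and> x = sum_list xs"
  proof induction
    case zero
    show ?case by (rule exI[of _ "[]"]) simp
  next
    case (step s x)
    then obtain xs where "set xs \<subseteq> S" "x = sum_list xs" by blast
    with step.hyps(1) show ?case by (intro exI[of _ "s # xs"]) simp
  qed
next
  have "set xs \<subseteq> S \<Longrightarrow> sum_list xs \<in> monoid_generated S" for xs
    by (induction xs) (auto intro: monoid_generated.intros)
  then show "\<exists>xs. set xs \<subseteq> S \<and> x = sum_list xs \<Longrightarrow> x \<in> monoid_generated S" by blast
qed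

lemma sum_list_map_cut_vector:
  "(\<Sum>A\<leftarrow>As. (cut_vector G A, 1::int)) = (\<lambda>e. \<Sum>A\<leftarrow>As. cut_vector G A e, int (length As))"
  by (induction As) (auto simp: zero_prod_def zero_fun_def plus_fun_def)

text \<open>Every generator has last coordinate 1, so the height \<open>h\<close> counts the cuts
  used, with multiplicity; height 4 thus means exactly four cuts.\<close>

lemma cut_monoid_iff:
  "(y, h) \<in> cut_monoid G \<longleftrightarrow>
     (\<exists>As. set As \<subseteq> Pow (fst G) \<and> (\<forall>e. y e = (\<Sum>A\<leftarrow>As. cut_vector G A e)) \<and> h = int (length As))"
proof -
  let ?g = "\<lambda>A. (cut_vector G A, 1::int)"
  have gens: "{(cut_vector G A, 1::int) | A. A \<subseteq> fst G} = ?g ` Pow (fst G)" by auto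
  have "(y, h) \<in> cut_monoid G \<longleftrightarrow>
      (\<exists>xs \<in> lists (?g ` Pow (fst G)). (y, h) = sum_list xs)"
    by (auto simp: cut_monoid_def monoid_generated_iff_sum_list gens lists_eq_set)
  \<comment> \<open>A list of generators lifts to a list of vertex sets by choosing one set behind
    each entry.\<close>
  also have "\<dots> \<longleftrightarrow> (\<exists>As \<in> lists (Pow (fst G)). (y, h) = (\<Sum>A\<leftarrow>As. ?g A))"
    by (simp only: lists_image bex_simps)
  finally show ?thesis
    by (auto simp: sum_list_map_cut_vector lists_eq_set fun_eq_iff)
qed

lemma cut_vector_complete_graph:
  assumes "p \<in> V" "q \<in> V" "p \<noteq> q"
  shows "cut_vector (complete_graph V) A {p, q} = of_bool ((p \<in> A) \<noteq> (q \<in> A))"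
  using assms by (auto simp: cut_vector_def complete_graph_def Int_insert_right)

text \<open>Cut vectors vanish off the edges, so membership reduces to counting, for each pair of
  vertices, the listed sets that separate it.\<close>

lemma cut_monoid_complete_graphI:
  assumes "set As \<subseteq> Pow V" and "h = int (length As)"
    and "\<And>e. \<not> (e \<subseteq> V \<and> card e = 2) \<Longrightarrow> y e = 0"
    and "\<And>p q. p \<in> V \<Longrightarrow> q \<in> V \<Longrightarrow> p \<noteq> q \<Longrightarrow>
           y {p, q} = (\<Sum>A\<leftarrow>As. of_bool ((p \<in> A) \<noteq> (q \<in> A)))"
  shows "(y, h) \<in> cut_monoid (complete_graph V)"
proof -
  have "y e = (\<Sum>A\<leftarrow>As. cut_vector (complete_graph V) A e)" for e
  proof (cases "e \<subseteq> V \<and> card e = 2")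
    case True
    then obtain p q where "e = {p, q}" "p \<noteq> q" "p \<in> V" "q \<in> V"
      by (auto simp: card_2_iff)
    then show ?thesis by (simp add: assms(4) cut_vector_complete_graph)
  next
    case False
    then have "cut_vector (complete_graph V) A e = 0" for A
      by (auto simp: cut_vector_def complete_graph_def)
    with False show ?thesis by (simp add: assms(3))
  qed
  with assms(1,2) show ?thesis
    unfolding cut_monoid_iff by (intro exI[of _ As]) (simp add: complete_graph_def)
qed

definition all_two :: "'a set \<Rightarrow> 'a set \<Rightarrow> int" where
  "all_two V = (\<lambda>e. if e \<subseteq> V \<and> card e = 2 then 2 else 0)"

lemma all_two_not_in_cut_monoid:
  assumes "distinct [a, b, c, d, e]" and V: "V = {a, b, c, d, e}"
  shows "(all_two V, 4) \<notin> cut_monoid (complete_graph V)"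
proof
  assume "(all_two V, 4) \<in> cut_monoid (complete_graph V)"
  then obtain As where As:
    "\<And>f. all_two V f = (\<Sum>A\<leftarrow>As. cut_vector (complete_graph V) A f)" and "length As = 4"
    unfolding cut_monoid_iff by auto
  from \<open>length As = 4\<close> obtain A B C D where eq: "As = [A, B, C, D]"
    by (auto simp: numeral_eq_Suc length_Suc_conv)
  have dist: "of_bool ((p \<in> A) \<noteq> (q \<in> A)) + of_bool ((p \<in> B) \<noteq> (q \<in> B)) +
      of_bool ((p \<in> C) \<noteq> (q \<in> C)) + of_bool ((p \<in> D) \<noteq> (q \<in> D)) = (2::int)"
    if "p \<in> V" "q \<in> V" "p \<noteq> q" for p q
    using As[of "{p, q}"] that by (simp add: eq cut_vector_complete_graph all_two_def)
  define same where "same p q S \<longleftrightarrow> (p \<in> S) = (q \<in> S)" for p q :: 'a and S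
  \<comment> \<open>the antipodal pair of \<open>p\<close>'s word, relative to the word of \<open>a\<close>\<close>
  define cls where "cls p = (same a p A = same a p B, same a p A = same a p C)" for p
  have cls_neq: "cls p \<noteq> cls q" if "p \<in> V" "q \<in> V" "p \<noteq> q" for p q
  proof -
    \<comment> \<open>The word of \<open>r\<close> differs from that of \<open>a\<close> in no place
      if \<open>r = a\<close>, and in two places otherwise.\<close>
    have parity: "even (of_bool (\<not> same a r A) + of_bool (\<not> same a r B) +
        of_bool (\<not> same a r C) + of_bool (\<not> same a r D) :: int)" if "r \<in> V" for r
      using dist[of a r] that V by (cases "r = a") (auto simp: same_def)
    \<comment> \<open>If \<open>cls p = cls q\<close>, the words of \<open>p\<close> and
      \<open>q\<close> agree in all of \<open>A\<close>, \<open>B\<close>, \<open>C\<close> or in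
      none. Parity extends this to \<open>D\<close>, giving distance 0 or 4 instead of 2.\<close>
    show ?thesis
      using dist[OF that] parity[OF that(1)] parity[OF that(2)]
      by (auto simp: cls_def same_def of_bool_def split: if_splits)
  qed
  then have "inj_on cls V" by (auto simp: inj_on_def)
  then have "card V \<le> card (UNIV :: (bool \<times> bool) set)"
    by (intro card_inj_on_le) auto
  moreover have "card (UNIV :: (bool \<times> bool) set) = 4"
    by (simp flip: UNIV_Times_UNIV add: card_cartesian_product)
  moreover have "card V = 5" using assms by simp
  ultimately show False by simp
qed

lemma sum_two_and_sum_three_in_cut_monoid:
  assumes "distinct [a, b, c, d, e]" and V: "V = {a, b, c, d, e}"
  defines "x \<equiv> (all_two V, 4::int)"
  shows "x + x \<in> cut_monoid (complete_graph V)" "x + x + x \<in> cut_monoid (complete_graph V)"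
proof -
  have neq: "a \<noteq> b" "a \<noteq> c" "a \<noteq> d" "a \<noteq> e" "b \<noteq> c" "b \<noteq> d" "b \<noteq> e" "c \<noteq> d" "c \<noteq> e" "d \<noteq> e"
    using assms(1) by auto
  have all_two_pair: "all_two V {p, q} = 2" if "p \<in> V" "q \<in> V" "p \<noteq> q" for p q
    using that by (simp add: all_two_def)
  have "(all_two V + all_two V, 8) \<in> cut_monoid (complete_graph V)"
  proof (rule cut_monoid_complete_graphI)
    \<comment> \<open>For \<open>v\<close>, \<open>w\<close> other than \<open>a\<close>, the pair
      \<open>a\<close>, \<open>v\<close> is separated by \<open>{v}\<close> and the three sets
      \<open>{a, u}\<close> with \<open>u \<noteq> v\<close>; the pair \<open>v\<close>,
      \<open>w\<close> by \<open>{v}\<close>, \<open>{w}\<close>, \<open>{a, v}\<close>,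
      \<open>{a, w}\<close>. Both counts are 4.\<close>
    let ?As = "[{b}, {c}, {d}, {e}, {a, b}, {a, c}, {a, d}, {a, e}]"
    show "set ?As \<subseteq> Pow V" "8 = int (length ?As)" by (simp_all add: V)
    show "(all_two V + all_two V) {p, q} = (\<Sum>A\<leftarrow>?As. of_bool ((p \<in> A) \<noteq> (q \<in> A)))"
      if "p \<in> V" "q \<in> V" "p \<noteq> q" for p q
      unfolding plus_fun_apply all_two_pair[OF that]
      using that unfolding V by (elim insertE emptyE) (simp_all add: neq neq[symmetric])
  qed (simp add: all_two_def)
  then show "x + x \<in> cut_monoid (complete_graph V)" by (simp add: x_def)
  have "(all_two V + all_two V + all_two V, 12) \<in> cut_monoid (complete_graph V)"
  proof (rule cut_monoid_complete_graphI)
    \<comment> \<open>Two vertices are separated by the 2 * 3 = 6 pairs containing exactly one of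
      them. The empty sets only raise the height from 10 to 12.\<close>
    let ?As = "[{}, {}, {a, b}, {a, c}, {a, d}, {a, e}, {b, c}, {b, d}, {b, e}, {c, d}, {c, e}, {d, e}]"
    show "set ?As \<subseteq> Pow V" "12 = int (length ?As)" by (simp_all add: V)
    show "(all_two V + all_two V + all_two V) {p, q} =
        (\<Sum>A\<leftarrow>?As. of_bool ((p \<in> A) \<noteq> (q \<in> A)))"
      if "p \<in> V" "q \<in> V" "p \<noteq> q" for p q
      unfolding plus_fun_apply all_two_pair[OF that]
      using that unfolding V by (elim insertE emptyE) (simp_all add: neq neq[symmetric])
  qed (simp add: all_two_def)
  then show "x + x + x \<in> cut_monoid (complete_graph V)" by (simp add: x_def)
qed

theorem theorem4p3:
  fixes V :: "'a set"
  assumes "card V = 5"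
  shows "\<not> cut_polytope_seminormal (complete_graph V) \<and>
         \<not> cut_polytope_normal (complete_graph V)"
proof -
  obtain a b c d e where V: "distinct [a, b, c, d, e]" "V = {a, b, c, d, e}"
  proof -
    obtain vs where vs: "set vs = V" "distinct vs"
      using assms finite_distinct_list[of V] by (metis card.infinite zero_neq_numeral)
    then have "length vs = 5" using assms distinct_card by metis
    then obtain a b c d e where "vs = [a, b, c, d, e]"
      by (auto simp: numeral_eq_Suc length_Suc_conv)
    with vs that show thesis by fastforce
  qed
  let ?M = "cut_monoid (complete_graph V)"
  define x where "x = (all_two V, 4::int)"
  have two: "x + x \<in> ?M" and three: "x + x + x \<in> ?M"
    using sum_two_and_sum_three_in_cut_monoid[OF V] by (simp_all add: x_def)
  have notin: "x \<notin> ?M"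
    using all_two_not_in_cut_monoid[OF V] by (simp add: x_def)
  have "(x + x + x) - (x + x) \<in> group_closure ?M"
    using two three by (blast intro: group_closure.intros)
  then have gp: "x \<in> group_closure ?M" by (simp add: algebra_simps)
  have "(\<Sum>i<(2::nat). x) \<in> ?M" using two by (simp add: numeral_eq_Suc)
  then have "\<not> normal_monoid ?M"
    unfolding normal_monoid_def using gp notin by (meson zero_less_numeral)
  with gp two three notin show ?thesis
    unfolding cut_polytope_seminormal_def cut_polytope_normal_def seminormal_monoid_def by blast
qed

end
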